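(* If a weighted tetrahedron $(\mathcal T,O)$ (with $O\in\operatorname{int}\mathcal T$) is monostable, then it has an unstable equilibrium on exactly two of its vertices.
   Context: $(\mathcal P,O)$, for a convex polyhedron $\mathcal P$ and $O\in\operatorname{int}\mathcal P$, is in equilibrium on a face, edge or vertex $X$ if there exists $Q$ in the relative interior of $X$ (a vertex being its own relative interior) such that the plane perpendicular to $[O,Q]$ at $Q$ supports $\mathcal P$; equilibria on faces are stable, on vertices unstable. $(\mathcal P,O)$ is monostable if exactly one face carries an equilibrium. *)

theory Defs
  imports "HOL-Analysis.Analysis"
begin

text \<open>The plane through Q perpendicular to [O,Q] supports P.  Since O lies in P and
  strictly on the side (x - Q) . (Q - z) < 0, supporting means P lies in the closed
  half-space containing O, and Q itself is a point of P.\<close>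
definition supports_perp_plane :: "'a::euclidean_space set \<Rightarrow> 'a \<Rightarrow> 'a \<Rightarrow> bool" where
  "supports_perp_plane P z Q \<longleftrightarrow> Q \<in> P \<and> (\<forall>x\<in>P. inner (x - Q) (Q - z) \<le> 0)"

definition equilibrium_on :: "'a::euclidean_space set \<Rightarrow> 'a \<Rightarrow> 'a set \<Rightarrow> bool" where
  "equilibrium_on P z X \<longleftrightarrow> (\<exists>Q\<in>rel_interior X. supports_perp_plane P z Q)"

definition faces2 :: "(real^3) set \<Rightarrow> (real^3) set set" where
  "faces2 P = {F. F face_of P \<and> aff_dim F = 2}"

definition monostable :: "(real^3) set \<Rightarrow> real^3 \<Rightarrow> bool" where
  "monostable P z \<longleftrightarrow> card {F \<in> faces2 P. equilibrium_on P z F} = 1"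

end

theory Submission
  imports Defs
begin

text \<open>
  Put the reference point at the origin, let \<open>v\<^sub>i\<close> be the vertices and \<open>p\<^sub>i\<close> the vertices of the
  polar tetrahedron, so that \<open>p\<^sub>i \<bullet> v\<^sub>j = 1\<close> for \<open>i \<noteq> j\<close>. Vertex \<open>i\<close> carries no equilibrium iff
  \<open>v\<^sub>i \<bullet> v\<^sub>j > v\<^sub>i \<bullet> v\<^sub>i\<close> for some \<open>j\<close> (\<open>i\<close> ``escapes'' to \<open>j\<close>), and the face opposite to \<open>i\<close>
  carries none iff \<open>p\<^sub>i \<bullet> p\<^sub>j \<ge> p\<^sub>i \<bullet> p\<^sub>i\<close> for some \<open>j \<noteq> i\<close>. In the monostable case the face escapes
  form a tree whose edges satisfy \<open>p\<^sub>i \<bullet> p\<^sub>j > 0\<close> (obtuse dihedral angles). Since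
  \<open>\<Sum>\<alpha>\<^sub>i p\<^sub>i = 0\<close> with positive weights, this tree is not a star, so it is a path \<open>0, 1, 2, 3\<close>.
  Then vertex 0 escapes to 2 and vertex 3 to 1, while vertices 1 and 2 do not escape.
\<close>

section \<open>Polar pairs of simplices and their duality\<close>

text \<open>The weights are the barycentric coordinates of the origin, and both simplices share
  them. The diagonal value \<open>1 - 1 / \<alpha> i\<close> comes from pairing \<open>p i\<close>
  with the vanishing weighted sum of the \<open>v j\<close>. The last assumption says that minus the
  weighted sum of the tensors of \<open>p k\<close> and \<open>v k\<close> is the identity. The
  conditions are symmetric in \<open>v\<close> and \<open>p\<close>.\<close>

locale polar_simplices =
  fixes I :: "'i set" and \<alpha> :: "'i \<Rightarrow> real" and v p :: "'i \<Rightarrow> 'a::euclidean_space"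
  assumes finite_I: "finite I"
    and weight_pos: "\<And>i. i \<in> I \<Longrightarrow> \<alpha> i > 0"
    and weight_sum: "sum \<alpha> I = 1"
    and inner_polar: "\<And>i j. i \<in> I \<Longrightarrow> j \<in> I \<Longrightarrow> p i \<bullet> v j = 1 - (if i = j then 1 / \<alpha> i else 0)"
    and inner_expand: "\<And>x y. x \<bullet> y = - (\<Sum>k\<in>I. \<alpha> k * (p k \<bullet> x) * (v k \<bullet> y))"
begin

lemma polar_dual: "polar_simplices I \<alpha> p v"
proof
  show "v i \<bullet> p j = 1 - (if i = j then 1 / \<alpha> i else 0)" if "i \<in> I" "j \<in> I" for i j
    using inner_polar[OF that(2,1)] by (auto simp: inner_commute)
  show "x \<bullet> y = - (\<Sum>k\<in>I. \<alpha> k * (v k \<bullet> x) * (p k \<bullet> y))" for x y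
    using inner_expand[of y x] by (simp add: inner_commute mult_ac)
qed (use finite_I weight_pos weight_sum in auto)

text \<open>By \<open>inner_polar\<close> this vector is orthogonal to every \<open>v j\<close>, so
  \<open>inner_expand\<close> makes its square norm zero.\<close>

lemma weighted_polar_sum: "(\<Sum>k\<in>I. \<alpha> k *\<^sub>R p k) = 0"
proof -
  let ?x = "\<Sum>k\<in>I. \<alpha> k *\<^sub>R p k"
  have "v j \<bullet> ?x = 0" if j: "j \<in> I" for j
  proof -
    have "v j \<bullet> ?x = (\<Sum>k\<in>I. \<alpha> k * (p k \<bullet> v j))"
      by (simp add: inner_sum_right inner_commute)
    also have "\<dots> = (\<Sum>k\<in>I. \<alpha> k - (if k = j then 1 else 0))"
      using j by (intro sum.cong) (auto simp: inner_polar right_diff_distrib dest: weight_pos)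
    also have "\<dots> = 0"
      using j by (simp add: sum_subtractf weight_sum finite_I)
    finally show ?thesis .
  qed
  then have "?x \<bullet> ?x = 0"
    by (subst inner_expand) simp
  then show ?thesis by simp
qed

lemma weighted_inner_sum: "(\<Sum>k\<in>I. \<alpha> k * (p k \<bullet> x)) = 0"
  using arg_cong[OF weighted_polar_sum, of "\<lambda>y. y \<bullet> x"] by (simp add: inner_sum_left)

lemma polar_ne:
  assumes "i \<in> I" "j \<in> I" "i \<noteq> j"
  shows "p i \<noteq> p j"
  using inner_polar[of i j] inner_polar[of j j] weight_pos[of j] assms by auto

text \<open>Expand the square norm of \<open>p i - p j\<close>, which is positive. Escapes therefore
  strictly increase the norm and cannot form cycles.\<close>

lemma escape_norm_less:
  assumes "i \<in> I" "j \<in> I" "i \<noteq> j" "p i \<bullet> p j \<ge> p i \<bullet> p i"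
  shows "p i \<bullet> p i < p j \<bullet> p j"
proof -
  have "0 < (p i - p j) \<bullet> (p i - p j)"
    using polar_ne[OF assms(1-3)] by simp
  then show ?thesis using assms(4)
    by (simp add: inner_diff_left inner_diff_right inner_commute)
qed

text \<open>The weighted sum of the \<open>p k\<close> vanishes, so \<open>inner_expand\<close>
  permits subtracting \<open>v i\<close> from each \<open>v k\<close>. This removes
  \<open>p i\<close> from the expansion.\<close>

lemma polar_expand:
  assumes "i \<in> I"
  shows "x = - (\<Sum>k\<in>I. (\<alpha> k * ((v k - v i) \<bullet> x)) *\<^sub>R p k)"
proof -
  have "y \<bullet> x = y \<bullet> (- (\<Sum>k\<in>I. (\<alpha> k * ((v k - v i) \<bullet> x)) *\<^sub>R p k))" for y
  proof -
    have "y \<bullet> (- (\<Sum>k\<in>I. (\<alpha> k * ((v k - v i) \<bullet> x)) *\<^sub>R p k)) =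
        - (\<Sum>k\<in>I. \<alpha> k * (p k \<bullet> y) * (v k \<bullet> x) - (v i \<bullet> x) * (\<alpha> k * (p k \<bullet> y)))"
      by (simp add: inner_sum_right inner_diff_left inner_commute algebra_simps)
    also have "\<dots> = y \<bullet> x"
      by (simp add: sum_subtractf flip: sum_distrib_left)
        (simp add: weighted_inner_sum flip: inner_expand)
    finally show ?thesis by simp
  qed
  then show ?thesis
    using vector_eq_ldot by blast
qed

section \<open>Signs of the inner products along an obtuse path\<close>

text \<open>Pairing the vanishing weighted sum with an inner node of the path leaves a single term
  that can be negative. For the two ends, a positive product would close a 4-cycle of positive
  products. The weighted sums over its two opposite pairs are negatives of each other, yet would
  have a positive inner product.\<close>

lemma obtuse_path_signs:
  assumes I: "I = {i, j, k, l}" "distinct [i, j, k, l]"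
    and "p i \<bullet> p j > 0" "p j \<bullet> p k > 0" "p k \<bullet> p l > 0"
  shows "p i \<bullet> p k < 0" "p j \<bullet> p l < 0" "p i \<bullet> p l \<le> 0"
proof -
  have pos: "\<alpha> i > 0" "\<alpha> j > 0" "\<alpha> k > 0" "\<alpha> l > 0"
    using I weight_pos by auto
  have sum0: "\<alpha> i * (p i \<bullet> x) + \<alpha> j * (p j \<bullet> x) + \<alpha> k * (p k \<bullet> x) + \<alpha> l * (p l \<bullet> x) = 0" for x
    using weighted_inner_sum[of x] I by (simp add: add.assoc)
  have self: "p j \<bullet> p j \<ge> 0" "p k \<bullet> p k \<ge> 0" by auto
  have "\<alpha> i * (p i \<bullet> p k) < 0"
    using sum0[of "p k"] mult_pos_pos[OF pos(2) assms(4)] mult_pos_pos[OF pos(4) assms(5)]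
      mult_nonneg_nonneg[OF less_imp_le[OF pos(3)] self(2)]
    by (simp add: inner_commute)
  then show ik: "p i \<bullet> p k < 0" using pos by (simp add: mult_less_0_iff)
  have "\<alpha> l * (p l \<bullet> p j) < 0"
    using sum0[of "p j"] mult_pos_pos[OF pos(1) assms(3)] mult_pos_pos[OF pos(3) assms(4)]
      mult_nonneg_nonneg[OF less_imp_le[OF pos(2)] self(1)]
    by (simp add: inner_commute)
  then show jl: "p j \<bullet> p l < 0" using pos by (simp add: mult_less_0_iff inner_commute)
  show "p i \<bullet> p l \<le> 0"
  proof (rule ccontr)
    assume il: "\<not> p i \<bullet> p l \<le> 0"
    let ?x = "\<alpha> i *\<^sub>R p i + \<alpha> k *\<^sub>R p k" and ?y = "\<alpha> j *\<^sub>R p j + \<alpha> l *\<^sub>R p l"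
    have "?x + ?y = 0"
      using weighted_polar_sum I by (simp add: add_ac)
    then have "?x = - ?y" by (simp only: eq_neg_iff_add_eq_0)
    then have "?x \<bullet> ?y \<le> 0" by (metis inner_ge_zero inner_minus_left neg_le_0_iff_le)
    moreover have "?x \<bullet> ?y = \<alpha> i * \<alpha> j * (p i \<bullet> p j) + \<alpha> i * \<alpha> l * (p i \<bullet> p l)
        + \<alpha> k * \<alpha> j * (p j \<bullet> p k) + \<alpha> k * \<alpha> l * (p k \<bullet> p l)"
      by (simp add: inner_add_left inner_add_right inner_commute algebra_simps)
    moreover have "\<dots> > 0"
      using pos assms il by (intro add_pos_pos mult_pos_pos) auto
    ultimately show False by linarith
  qed
qed

section \<open>From escapes of polar vertices to escapes of vertices\<close>

text \<open>The edge vector \<open>w = v k - v i\<close> is orthogonal to \<open>p j\<close> and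
  \<open>p l\<close>, the normals of the two faces at that edge. Expanding \<open>w\<close> by
  \<open>polar_expand\<close> and solving for \<open>p k\<close> gives the formula with
  \<open>t = 1 / s\<close>. Pairing with \<open>v i\<close>, where all three polar vectors take the
  value 1, gives the sum of the coefficients.\<close>

lemma polar_decomposition:
  assumes I: "I = {i, j, k, l}" "distinct [i, j, k, l]"
  obtains x y t where "p k = x *\<^sub>R p j + y *\<^sub>R p l - t *\<^sub>R (v k - v i)"
    "t > 0" "x + y = 1 + t * (v i \<bullet> (v k - v i))"
proof -
  define w where "w = v k - v i"
  have "w \<noteq> 0"
    using polar_simplices.polar_ne[OF polar_dual, of k i] I by (auto simp: w_def)
  have pos: "\<alpha> k > 0" using I weight_pos by auto
  define s where "s = \<alpha> k * (w \<bullet> w)"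
  have s: "s > 0" using \<open>w \<noteq> 0\<close> pos by (simp add: s_def)
  define x where "x = - (\<alpha> j * ((v j - v i) \<bullet> w)) / s"
  define y where "y = - (\<alpha> l * ((v l - v i) \<bullet> w)) / s"
  have sx: "s * x = - (\<alpha> j * ((v j - v i) \<bullet> w))" "s * y = - (\<alpha> l * ((v l - v i) \<bullet> w))"
    using s by (simp_all add: x_def y_def)
  have "w = - (\<Sum>m\<in>I. (\<alpha> m * ((v m - v i) \<bullet> w)) *\<^sub>R p m)"
    using polar_expand[of i w] I by simp
  also have "\<dots> = (s * x) *\<^sub>R p j + (s * y) *\<^sub>R p l - s *\<^sub>R p k"
    using I unfolding sx by (simp add: s_def flip: w_def)
  finally have w: "s *\<^sub>R p k = (s * x) *\<^sub>R p j + (s * y) *\<^sub>R p l - w"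
    by (simp add: algebra_simps)
  have "p k = (1 / s) *\<^sub>R (s *\<^sub>R p k)" using s by simp
  also have "\<dots> = x *\<^sub>R p j + y *\<^sub>R p l - (1 / s) *\<^sub>R w"
    unfolding w using s by (simp add: algebra_simps)
  finally have pk: "p k = x *\<^sub>R p j + y *\<^sub>R p l - (1 / s) *\<^sub>R w" .
  have "p k \<bullet> v i = 1" "p j \<bullet> v i = 1" "p l \<bullet> v i = 1"
    using I inner_polar by auto
  then have "1 = x + y - (1 / s) * (v i \<bullet> w)"
    by (subst (asm) pk) (simp add: inner_diff_left inner_add_left inner_commute[of w])
  then show thesis
    using that[of x y "1 / s"] pk s by (simp add: w_def)
qed

text \<open>In the decomposition of \<open>p k\<close>, vertex \<open>i\<close> escapes to
  \<open>k\<close> as soon as \<open>x + y > 1\<close>. The hypotheses, paired with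
  \<open>p j\<close> and \<open>p l\<close>, become linear inequalities in \<open>x\<close> and
  \<open>y\<close> that force \<open>y > 0\<close> and \<open>x > 1\<close>.\<close>

lemma polar_escape_imp_vertex_escape:
  assumes I: "I = {i, j, k, l}" "distinct [i, j, k, l]"
    and "p k \<bullet> p l > 0" "p j \<bullet> p l < 0" and esc: "p j \<bullet> p k \<ge> p j \<bullet> p j"
  shows "v i \<bullet> v k > v i \<bullet> v i"
proof -
  obtain x y t where pk: "p k = x *\<^sub>R p j + y *\<^sub>R p l - t *\<^sub>R (v k - v i)"
    and t: "t > 0" and xy: "x + y = 1 + t * (v i \<bullet> (v k - v i))"
    using polar_decomposition[OF I] by blast
  have "p j \<bullet> (v k - v i) = 0" "p l \<bullet> (v k - v i) = 0"
    using I inner_polar by (auto simp: inner_diff_right)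
  then have jk: "p j \<bullet> p k = x * (p j \<bullet> p j) + y * (p j \<bullet> p l)"
    and kl: "p k \<bullet> p l = x * (p j \<bullet> p l) + y * (p l \<bullet> p l)"
    by (simp_all add: pk inner_diff_left inner_diff_right inner_add_left inner_add_right inner_commute)
  define A B C where "A = p j \<bullet> p j" "B = p l \<bullet> p l" "C = - (p j \<bullet> p l)"
  have C: "C > 0" using assms by (simp add: A_B_C_def)
  have "p j \<noteq> 0" "p l \<noteq> 0" using assms by auto
  then have AB: "A > 0" "B > 0" by (auto simp: A_B_C_def)
  have CS: "C * C \<le> A * B"
    using Cauchy_Schwarz_ineq[of "p j" "p l"] by (simp add: A_B_C_def power2_eq_square)
  have 1: "x * A \<ge> A + y * C" and 2: "y * B > x * C"
    using assms jk kl by (simp_all add: A_B_C_def)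
  \<comment> \<open>Combining \<open>C\<close> times \<open>1\<close> with \<open>A\<close> times
    \<open>2\<close> gives \<open>y * (A * B - C * C) > C * A > 0\<close>, and the bracket is
    nonnegative by Cauchy-Schwarz.\<close>
  have "y > 0"
  proof (rule ccontr)
    assume "\<not> y > 0"
    then have "y \<le> 0" by simp
    have "C * (x * A) \<ge> C * A + y * (C * C)"
      using mult_left_mono[OF 1, of C] C by (simp add: algebra_simps)
    moreover have "A * (y * B) > C * (x * A)"
      using mult_strict_left_mono[OF 2 AB(1)] by (simp add: algebra_simps)
    moreover have "y * (A * B) \<le> y * (C * C)"
      using CS \<open>y \<le> 0\<close> by (rule mult_left_mono_neg)
    moreover have "C * A > 0" using C AB by simp
    ultimately show False by (simp add: algebra_simps)
  qed
  have "x * A > 1 * A"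
    using 1 mult_pos_pos[OF \<open>y > 0\<close> C] by linarith
  then have "x > 1" using AB by (simp only: mult_less_cancel_right_pos)
  with xy \<open>y > 0\<close> have "t * (v i \<bullet> (v k - v i)) > 0" by linarith
  then show ?thesis using t by (simp add: zero_less_mult_iff inner_diff_right)
qed

section \<open>Equilibrium at the middle vertices of the path\<close>

text \<open>An escape along the middle edge would fix the signs of \<open>x + y\<close> and
  \<open>x' + y'\<close> when \<open>p k\<close> and \<open>p j\<close> are decomposed over
  \<open>p i\<close>, \<open>p l\<close> and the edge vector. With the obtuse signs these contradict
  Cauchy-Schwarz for \<open>p i\<close> and \<open>p l\<close>.\<close>

lemma middle_vertices_no_escape:
  assumes I: "I = {i, j, k, l}" "distinct [i, j, k, l]"
    and ij: "p i \<bullet> p j > 0" and jk: "p j \<bullet> p k > 0" and kl: "p k \<bullet> p l > 0"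
  shows "v j \<bullet> v k \<le> v j \<bullet> v j"
proof (rule ccontr)
  assume "\<not> ?thesis"
  then have vw: "v j \<bullet> (v k - v j) > 0" by (simp add: inner_diff_right)
  note signs = obtuse_path_signs[OF assms]
  have pos: "\<alpha> j > 0" "\<alpha> k > 0" using I weight_pos by auto
  have "I = {j, i, k, l}" "distinct [j, i, k, l]" using I by auto
  then obtain x y t where pk: "p k = x *\<^sub>R p i + y *\<^sub>R p l - t *\<^sub>R (v k - v j)"
    and t: "t > 0" and xy: "x + y = 1 + t * (v j \<bullet> (v k - v j))"
    using polar_decomposition by blast
  have "I = {k, i, j, l}" "distinct [k, i, j, l]" using I by auto
  then obtain x' y' t' where pj: "p j = x' *\<^sub>R p i + y' *\<^sub>R p l - t' *\<^sub>R (v j - v k)"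
    and t': "t' > 0"
    using polar_decomposition by blast
  have w0: "p i \<bullet> (v k - v j) = 0" "p l \<bullet> (v k - v j) = 0"
    "p i \<bullet> (v j - v k) = 0" "p l \<bullet> (v j - v k) = 0"
    and wj: "p j \<bullet> (v k - v j) > 0" and wk: "p k \<bullet> (v j - v k) > 0"
    and vj: "p i \<bullet> v j = 1" "p l \<bullet> v j = 1" "p j \<bullet> v j = 1 - 1 / \<alpha> j"
    using I inner_polar pos by (auto simp: inner_diff_right)
  have xy_pos: "x + y > 0" using xy t vw by (simp add: add_pos_pos)
  \<comment> \<open>At \<open>v j\<close> the vectors \<open>p i\<close> and \<open>p l\<close> take
    the value 1, while \<open>p j\<close> takes a value \<le> 0 because a weight is at most 1. Hence
    \<open>x' + y' < 0\<close>.\<close>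
  have "p j \<bullet> v j = x' + y' + t' * (v j \<bullet> (v k - v j))"
    by (subst pj) (simp add: inner_diff_left inner_add_left vj inner_diff_right inner_commute algebra_simps)
  moreover have "1 - 1 / \<alpha> j \<le> 0"
  proof -
    have "\<alpha> j \<le> sum \<alpha> I"
      using I weight_pos finite_I by (intro member_le_sum) (auto intro: less_imp_le)
    then show ?thesis using pos weight_sum by simp
  qed
  moreover have "t' * (v j \<bullet> (v k - v j)) > 0" using t' vw by simp
  ultimately have xy'_neg: "x' + y' < 0" using vj by linarith
  define A B C where "A = p i \<bullet> p i" "B = p l \<bullet> p l" "C = - (p i \<bullet> p l)"
  have "p i \<noteq> 0" "p l \<noteq> 0" using assms by auto
  then have AB: "A > 0" "B > 0" by (auto simp: A_B_C_def)
  have C: "C \<ge> 0" using signs by (simp add: A_B_C_def)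
  have CS: "C * C \<le> A * B"
    using Cauchy_Schwarz_ineq[of "p i" "p l"] by (simp add: A_B_C_def power2_eq_square)
  have ik_eq: "p i \<bullet> p k = x * A - y * C" and kl_eq: "p k \<bullet> p l = y * B - x * C"
    using w0 by (simp_all add: pk A_B_C_def inner_diff_left inner_diff_right inner_add_left
        inner_add_right inner_commute)
  have ij_eq: "p i \<bullet> p j = x' * A - y' * C"
    using w0 by (simp add: pj A_B_C_def inner_diff_left inner_diff_right inner_add_left
        inner_add_right inner_commute)
  \<comment> \<open>The edge component contributes negatively to \<open>p j \<bullet> p k\<close>,
    so the components in the span of \<open>p i\<close> and \<open>p l\<close> have positive inner
    product. The same is then computed from the decomposition of \<open>p j\<close>.\<close>
  have "p j \<bullet> p k = x * (p i \<bullet> p j) + y * (p j \<bullet> p l) - t * (p j \<bullet> (v k - v j))"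
    by (subst pk) (simp add: inner_diff_right inner_add_right inner_commute)
  then have m: "x * (p i \<bullet> p j) + y * (p j \<bullet> p l) > 0"
    using jk mult_pos_pos[OF t wj] by linarith
  have "p j \<bullet> p k = x' * (p i \<bullet> p k) + y' * (p k \<bullet> p l) - t' * (p k \<bullet> (v j - v k))"
    by (subst pj) (simp add: inner_diff_left inner_add_left inner_add_right inner_diff_right inner_commute)
  then have m': "x' * (p i \<bullet> p k) + y' * (p k \<bullet> p l) > 0"
    using jk mult_pos_pos[OF t' wk] by linarith
  have "x > 0"
  proof (rule ccontr)
    assume "\<not> x > 0"
    with xy_pos have "x \<le> 0" "y > 0" by auto
    then show False
      using m mult_nonpos_nonneg[of x "p i \<bullet> p j"] mult_pos_neg[of y "p j \<bullet> p l"] ij signs by auto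
  qed
  have "x' < 0"
  proof (rule ccontr)
    assume "\<not> x' < 0"
    with xy'_neg have "x' \<ge> 0" "y' < 0" by auto
    then show False
      using m' mult_nonneg_nonpos[of x' "p i \<bullet> p k"] mult_neg_pos[of y' "p k \<bullet> p l"] kl signs by auto
  qed
  have "y * C > x * A" using ik_eq signs by simp
  then have yC: "y * C > 0" using mult_pos_pos[OF \<open>x > 0\<close> AB(1)] by linarith
  then have "C > 0" "y > 0" using C by (auto simp: zero_less_mult_iff)
  \<comment> \<open>The two positive quantities are chosen so that \<open>y'\<close> and
    \<open>x\<close> cancel in their sum, which is \<open>x' * y * (A * B - C * C)\<close>.\<close>
  have "(x' * A - y' * C) * (y * B - x * C) > 0"
    using ij kl ij_eq kl_eq by simp
  moreover have "C * (x' * (x * A - y * C) + y' * (y * B - x * C)) > 0"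
    using m' \<open>C > 0\<close> ik_eq kl_eq by simp
  ultimately have "x' * y * (A * B - C * C) > 0"
    by (simp add: algebra_simps)
  moreover have "x' * y * (A * B - C * C) \<le> 0"
    using \<open>x' < 0\<close> \<open>y > 0\<close> CS by (simp add: mult_nonpos_nonneg mult_neg_pos less_imp_le)
  ultimately show False by simp
qed

text \<open>An escape from \<open>j\<close> to \<open>i\<close> is excluded by applying the escape lemma to the dual pair along the
  path \<open>l, j, i, k\<close>: it would give \<open>p l \<bullet> p i > 0\<close>.\<close>

lemma middle_vertex_equilibrium:
  assumes I: "I = {i, j, k, l}" "distinct [i, j, k, l]"
    and ij: "p i \<bullet> p j > 0" and jk: "p j \<bullet> p k > 0" and kl: "p k \<bullet> p l > 0"
    and ik_esc: "v i \<bullet> v k > v i \<bullet> v i" and lj_esc: "v l \<bullet> v j > v l \<bullet> v l"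
  shows "\<forall>m\<in>I. v j \<bullet> v m \<le> v j \<bullet> v j"
proof -
  interpret dual: polar_simplices I \<alpha> p v by (rule polar_dual)
  have "v j \<bullet> v k \<le> v j \<bullet> v j"
    using middle_vertices_no_escape[OF I ij jk kl] .
  moreover have "v j \<bullet> v l \<le> v j \<bullet> v j"
    \<comment> \<open>Since \<open>l\<close> escapes to \<open>j\<close>, \<open>v j\<close> is
      longer than \<open>v l\<close>, so there is no escape back.\<close>
    using dual.escape_norm_less[of l j] dual.escape_norm_less[of j l] lj_esc I by fastforce
  moreover have "v j \<bullet> v i \<le> v j \<bullet> v j"
  proof (rule ccontr)
    assume "\<not> ?thesis"
    then have ji: "v j \<bullet> v i > v j \<bullet> v j" by simp
    have nn: "v i \<bullet> v i \<ge> 0" "v j \<bullet> v j \<ge> 0" "v l \<bullet> v l \<ge> 0" by auto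
    have I': "I = {l, j, i, k}" "distinct [l, j, i, k]" using I by auto
    have lj: "v l \<bullet> v j > 0" and ji0: "v j \<bullet> v i > 0" and ik: "v i \<bullet> v k > 0"
      using nn ji ik_esc lj_esc by linarith+
    have "v j \<bullet> v k < 0"
      using dual.obtuse_path_signs(2)[OF I' lj ji0 ik] .
    then have "p l \<bullet> p i > p l \<bullet> p l"
      using dual.polar_escape_imp_vertex_escape[OF I' ik] ji by simp
    moreover have "p l \<bullet> p l \<ge> 0" by simp
    ultimately show False
      using obtuse_path_signs(3)[OF I ij jk kl] by (simp add: inner_commute)
  qed
  ultimately show ?thesis using I by simp
qed

section \<open>The tree of face escapes and the resulting count of vertices\<close>

text \<open>By uniqueness every index but the one of largest norm escapes, and always to a larger
  norm. This gives a tree on four nodes, which is a star or a path. The disjunction records the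
  direction of the escape on the middle edge or on the last edge; either suffices to make vertex
  \<open>i\<close> escape to \<open>k\<close>.\<close>

lemma obtuse_path_exists:
  assumes card: "card I = 4"
    and uniq: "\<And>i j. \<lbrakk>i \<in> I; j \<in> I; \<forall>k\<in>I - {i}. p i \<bullet> p k < p i \<bullet> p i; \<forall>k\<in>I - {j}. p j \<bullet> p k < p j \<bullet> p j\<rbrakk>
      \<Longrightarrow> i = j"
  obtains i j k l where "I = {i, j, k, l}" "distinct [i, j, k, l]"
    "p j \<bullet> p k > 0" "p k \<bullet> p l > 0" "p i \<bullet> p j \<ge> p i \<bullet> p i"
    "p j \<bullet> p k \<ge> p j \<bullet> p j \<or> p l \<bullet> p k \<ge> p l \<bullet> p l" "p i \<bullet> p j > 0"
proof -
  define E where "E i j \<longleftrightarrow> p i \<bullet> p j \<ge> p i \<bullet> p i" for i j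
  \<comment> \<open>The sign in the sort key lists the indices by decreasing norm, so escapes lead
    only to earlier entries.\<close>
  define f where "f i = - (p i \<bullet> p i)" for i
  obtain xs where xs: "set xs = I" "distinct xs"
    using finite_distinct_list[OF finite_I] by blast
  define ys where "ys = sort_key f xs"
  have ys: "set ys = I" "distinct ys" "sorted (map f ys)"
    by (simp_all add: ys_def xs)
  have "length ys = 4" using card ys distinct_card by metis
  then obtain a b c d where abcd: "ys = [a, b, c, d]"
    by (auto simp: numeral_eq_Suc length_Suc_conv)
  have I: "I = {a, b, c, d}" "distinct [a, b, c, d]" using ys abcd by auto
  have ord: "p a \<bullet> p a \<ge> p b \<bullet> p b" "p b \<bullet> p b \<ge> p c \<bullet> p c" "p c \<bullet> p c \<ge> p d \<bullet> p d"
    using ys(3) by (simp_all add: abcd f_def)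
  have less: "p i \<bullet> p i < p j \<bullet> p j" if "E i j" "i \<in> I" "j \<in> I" "i \<noteq> j" for i j
    using escape_norm_less that unfolding E_def by blast
  have nE: "\<not> E a b" "\<not> E a c" "\<not> E a d" "\<not> E b c" "\<not> E b d" "\<not> E c d"
    using less[of a b] less[of a c] less[of a d] less[of b c] less[of b d] less[of c d] I ord
    by auto
  have a: "\<forall>k\<in>I - {a}. p a \<bullet> p k < p a \<bullet> p a"
    using nE I by (auto simp: E_def)
  have esc: "\<exists>k\<in>I - {i}. E i k" if "i \<in> I" "i \<noteq> a" for i
  proof (rule ccontr)
    assume "\<not> ?thesis"
    then have "\<forall>k\<in>I - {i}. p i \<bullet> p k < p i \<bullet> p i"
      by (simp add: E_def not_le)
    moreover have "a \<in> I" using I by simp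
    ultimately show False using uniq[OF that(1) _ _ a] that(2) by blast
  qed
  have ba: "E b a" using esc[of b] I nE by auto
  have c: "E c a \<or> E c b" using esc[of c] I nE by auto
  have d: "E d a \<or> E d b \<or> E d c" using esc[of d] I nE by auto
  \<comment> \<open>\<open>p i\<close> takes the value 1 at any other \<open>v j\<close>. Being
    nonzero, it turns each escape into a positive inner product.\<close>
  have "p i \<noteq> 0" if "i \<in> I" for i
  proof -
    obtain j where "j \<in> I" "j \<noteq> i"
      using I by (metis distinct_length_2_or_more insertI1 insertI2)
    then show ?thesis using inner_polar[of i j] that by auto
  qed
  then have pos: "p i \<bullet> p j > 0" "p j \<bullet> p i > 0" if "E i j" "i \<in> I" for i j
    using that inner_gt_zero_iff[of "p i"] less_le_trans unfolding E_def by (metis inner_commute)+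
  \<comment> \<open>At the centre of a star, pairing the vanishing weighted sum with
    \<open>p i\<close> would give a positive number.\<close>
  have no_star: False if "I = {i, j, k, l}" "distinct [i, j, k, l]"
    "p i \<bullet> p j > 0" "p i \<bullet> p k > 0" "p i \<bullet> p l > 0" for i j k l
  proof -
    have "\<alpha> i * (p i \<bullet> p i) + \<alpha> j * (p i \<bullet> p j) + \<alpha> k * (p i \<bullet> p k) + \<alpha> l * (p i \<bullet> p l) = 0"
      using weighted_inner_sum[of "p i"] that(1,2) by (simp add: inner_commute)
    moreover have "\<alpha> i * (p i \<bullet> p i) \<ge> 0" "\<alpha> j * (p i \<bullet> p j) > 0" "\<alpha> k * (p i \<bullet> p k) > 0" "\<alpha> l * (p i \<bullet> p l) > 0"
      using that weight_pos[of i] weight_pos[of j] weight_pos[of k] weight_pos[of l] by auto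
    ultimately show False by linarith
  qed
  have sets: "I = {b, a, c, d}" "I = {c, a, b, d}" "I = {d, a, b, c}" "I = {d, c, b, a}"
    using I by auto
  have mem: "a \<in> I" "b \<in> I" "c \<in> I" "d \<in> I" using I by auto
  \<comment> \<open>Of the six choices of targets for \<open>c\<close> and \<open>d\<close>, two
    give stars centred at \<open>a\<close> and \<open>b\<close>. The others give the paths
    \<open>c a b d\<close>, \<open>b a c d\<close>, \<open>d a b c\<close> and
    \<open>d c b a\<close>.\<close>
  consider "E c a" "E d b" | "E c a" "E d c" | "E c b" "E d a" | "E c b" "E d c"
  proof -
    have "\<not> (E c a \<and> E d a)"
      using no_star[of a b c d] I pos[OF ba mem(2)] pos[of c a] pos[of d a] mem by auto
    moreover have "\<not> (E c b \<and> E d b)"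
      using no_star[of b a c d] sets(1) I(2) pos[OF ba mem(2)] pos[of c b] pos[of d b] mem by auto
    ultimately show thesis using c d that by blast
  qed
  then show thesis
  proof cases
    case 1
    show thesis
      by (rule that[OF sets(2)]) (use 1 I(2) ba pos mem in \<open>auto simp: E_def\<close>)
  next
    case 2
    show thesis
      by (rule that[OF sets(1)]) (use 2 I(2) ba pos mem in \<open>auto simp: E_def\<close>)
  next
    case 3
    show thesis
      by (rule that[OF sets(3)]) (use 3 I(2) ba pos mem in \<open>auto simp: E_def\<close>)
  next
    case 4
    show thesis
      by (rule that[OF sets(4)]) (use 4 I(2) ba pos mem in \<open>auto simp: E_def\<close>)
  qed
qed

text \<open>On the path \<open>i j k l\<close> the end vertices escape, \<open>i\<close> to
  \<open>k\<close> and \<open>l\<close> to \<open>j\<close>, and the middle ones do not.\<close>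

lemma card_vertex_equilibria:
  assumes card: "card I = 4"
    and uniq: "\<And>i j. \<lbrakk>i \<in> I; j \<in> I; \<forall>k\<in>I - {i}. p i \<bullet> p k < p i \<bullet> p i; \<forall>k\<in>I - {j}. p j \<bullet> p k < p j \<bullet> p j\<rbrakk>
      \<Longrightarrow> i = j"
  shows "card {i \<in> I. \<forall>m\<in>I. v i \<bullet> v m \<le> v i \<bullet> v i} = 2"
proof -
  obtain i j k l where I: "I = {i, j, k, l}" "distinct [i, j, k, l]"
    and jk: "p j \<bullet> p k > 0" and kl: "p k \<bullet> p l > 0" and ij_esc: "p i \<bullet> p j \<ge> p i \<bullet> p i"
    and k_esc: "p j \<bullet> p k \<ge> p j \<bullet> p j \<or> p l \<bullet> p k \<ge> p l \<bullet> p l" and ij: "p i \<bullet> p j > 0"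
    using obtuse_path_exists[OF assms] by blast
  \<comment> \<open>\<open>I1\<close> exchanges the two faces at the edge \<open>i k\<close>,
    \<open>I2\<close> serves the edge \<open>l j\<close>, and \<open>I3\<close> reverses the path to
    treat \<open>k\<close> like \<open>j\<close>.\<close>
  have I1: "I = {i, l, k, j}" "distinct [i, l, k, j]"
    and I2: "I = {l, i, j, k}" "distinct [l, i, j, k]"
    and I3: "I = {l, k, j, i}" "distinct [l, k, j, i]" using I by auto
  note signs = obtuse_path_signs[OF I ij jk kl]
  have com: "p k \<bullet> p j > 0" "p l \<bullet> p k > 0" "p j \<bullet> p i > 0" "p l \<bullet> p j < 0"
    using ij jk kl signs by (simp_all add: inner_commute)
  have ik: "v i \<bullet> v k > v i \<bullet> v i"
    using k_esc polar_escape_imp_vertex_escape[OF I kl signs(2)]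
      polar_escape_imp_vertex_escape[OF I1 com(1,4)] by blast
  have lj: "v l \<bullet> v j > v l \<bullet> v l"
    using polar_escape_imp_vertex_escape[OF I2 jk signs(1) ij_esc] .
  have "\<forall>m\<in>I. v j \<bullet> v m \<le> v j \<bullet> v j"
    by (rule middle_vertex_equilibrium[OF I ij jk kl ik lj])
  moreover have "\<forall>m\<in>I. v k \<bullet> v m \<le> v k \<bullet> v k"
    by (rule middle_vertex_equilibrium[OF I3 com(2,1,3) lj ik])
  moreover have "\<not> (\<forall>m\<in>I. v i \<bullet> v m \<le> v i \<bullet> v i)" "\<not> (\<forall>m\<in>I. v l \<bullet> v m \<le> v l \<bullet> v l)"
    using ik lj I(1) by (auto simp: not_le)
  ultimately have "{i \<in> I. \<forall>m\<in>I. v i \<bullet> v m \<le> v i \<bullet> v i} = {j, k}"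
    using I(1) by blast
  then show ?thesis using I(2) by simp
qed

end

section \<open>The polar of a weighted simplex, and equilibria as inner product conditions\<close>

text \<open>The weights are the barycentric coordinates of \<open>z\<close>, positive because
  \<open>z\<close> is interior. \<open>p s\<close> is the normal of the hyperplane through the facet
  opposite to \<open>s\<close>, scaled to take the value 1 there relative to
  \<open>z\<close>.\<close>

lemma polar_simplices_exist:
  fixes S :: "'a::euclidean_space set"
  assumes indep: "\<not> affine_dependent S" and card: "card S = Suc DIM('a)"
    and z: "z \<in> interior (convex hull S)"
  obtains \<alpha> p where "polar_simplices S \<alpha> (\<lambda>x. x - z) p"
proof -
  have fin: "finite S" using indep aff_independent_finite by blast
  have "z \<in> {y. \<exists>u. (\<forall>x\<in>S. 0 < u x) \<and> sum u S = 1 \<and> (\<Sum>x\<in>S. u x *\<^sub>R x) = y}"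
    using z unfolding interior_convex_hull_explicit_minimal[OF indep] card by simp
  then obtain \<alpha> where pos: "\<And>x. x \<in> S \<Longrightarrow> 0 < \<alpha> x" and sum1: "sum \<alpha> S = 1"
    and bary: "(\<Sum>x\<in>S. \<alpha> x *\<^sub>R x) = z" by blast
  have ex: "\<exists>q. \<forall>x\<in>S - {s}. q \<bullet> (x - z) = 1" if s: "s \<in> S" for s
  proof -
    have "aff_dim (S - {s}) = int (card (S - {s})) - 1"
      using aff_dim_affine_independent[OF affine_independent_Diff[OF indep, of "{s}"]] by simp
    then have "aff_dim (S - {s}) = DIM('a) - 1" using s fin card by simp
    then obtain n b where "affine hull (S - {s}) = {x. n \<bullet> x = b}"
      using aff_dim_eq_hyperplane by blast
    moreover have "s \<notin> affine hull (S - {s})"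
      using indep s unfolding affine_dependent_def by blast
    moreover have "x \<in> affine hull (S - {s})" if "x \<in> S - {s}" for x
      using that by (rule hull_inc)
    ultimately have sb: "n \<bullet> s \<noteq> b" and xb: "\<And>x. x \<in> S - {s} \<Longrightarrow> n \<bullet> x = b" by auto
    \<comment> \<open>Only \<open>s\<close> contributes to this average, so \<open>z\<close> is off
      the hyperplane and the normal can be rescaled by
      \<open>1 / (b - n \<bullet> z)\<close>.\<close>
    have "n \<bullet> z - b = (\<Sum>x\<in>S. \<alpha> x * (n \<bullet> x - b))"
      unfolding bary[symmetric]
      by (simp add: inner_sum_right right_diff_distrib sum_subtractf sum1 flip: sum_distrib_right)
    also have "\<dots> = \<alpha> s * (n \<bullet> s - b)"
      using s fin xb by (subst sum.remove[of _ s]) auto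
    finally have "n \<bullet> z \<noteq> b" using sb pos[OF s] by auto
    then have "\<forall>x\<in>S - {s}. ((1 / (b - n \<bullet> z)) *\<^sub>R n) \<bullet> (x - z) = 1"
      using xb by (simp add: inner_diff_right flip: diff_divide_distrib)
    then show ?thesis ..
  qed
  then obtain p where p: "\<And>s x. s \<in> S \<Longrightarrow> x \<in> S - {s} \<Longrightarrow> p s \<bullet> (x - z) = 1"
    by metis
  have zero: "(\<Sum>x\<in>S. \<alpha> x *\<^sub>R (x - z)) = 0"
    using bary sum1 by (simp add: scaleR_diff_right sum_subtractf flip: scaleR_left.sum)
  have pp: "p i \<bullet> (j - z) = 1 - (if i = j then 1 / \<alpha> i else 0)" if "i \<in> S" "j \<in> S" for i j
  proof (cases "i = j")
    case True
    have "0 = p i \<bullet> (\<Sum>x\<in>S. \<alpha> x *\<^sub>R (x - z))" by (simp add: zero)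
    also have "\<dots> = (\<Sum>x\<in>S. \<alpha> x * (p i \<bullet> (x - z)))" by (simp add: inner_sum_right)
    also have "\<dots> = \<alpha> i * (p i \<bullet> (i - z)) + (\<Sum>x\<in>S - {i}. \<alpha> x)"
      using p that(1) fin by (subst sum.remove[of _ i]) auto
    also have "(\<Sum>x\<in>S - {i}. \<alpha> x) = 1 - \<alpha> i"
      using sum1 fin that(1) by (simp add: sum_diff1)
    finally show ?thesis using pos[OF that(1)] True by (simp add: field_simps)
  qed (use p that in auto)
  have expand: "y = - (\<Sum>k\<in>S. (\<alpha> k * (p k \<bullet> y)) *\<^sub>R (k - z))" for y
  proof -
    \<comment> \<open>In barycentric coordinates \<open>u\<close> of \<open>y + z\<close>, the
      coefficient \<open>\<alpha> k * (p k \<bullet> y)\<close> is \<open>\<alpha> k - u k\<close>,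
      and the part with \<open>\<alpha> k\<close> sums to zero.\<close>
    have "y + z \<in> affine hull S"
      using affine_independent_span_eq[OF indep] card by simp
    then obtain u where u: "sum u S = 1" "(\<Sum>x\<in>S. u x *\<^sub>R x) = y + z"
      using affine_hull_finite[OF fin] by auto
    have y: "y = (\<Sum>x\<in>S. u x *\<^sub>R (x - z))"
      using u by (simp add: scaleR_diff_right sum_subtractf flip: scaleR_left.sum)
    have py: "\<alpha> k * (p k \<bullet> y) = \<alpha> k - u k" if k: "k \<in> S" for k
    proof -
      have "p k \<bullet> y = (\<Sum>x\<in>S. u x * (p k \<bullet> (x - z)))"
        by (subst y) (simp add: inner_sum_right)
      also have "\<dots> = (\<Sum>x\<in>S. u x - (if x = k then u k / \<alpha> k else 0))"
        using k by (intro sum.cong) (auto simp: pp right_diff_distrib)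
      also have "\<dots> = 1 - u k / \<alpha> k" using k fin u by (simp add: sum_subtractf)
      finally show ?thesis using pos[OF k] by (simp add: field_simps)
    qed
    have "(\<Sum>k\<in>S. (\<alpha> k * (p k \<bullet> y)) *\<^sub>R (k - z)) = (\<Sum>k\<in>S. (\<alpha> k - u k) *\<^sub>R (k - z))"
      by (intro sum.cong) (simp_all add: py)
    also have "\<dots> = - y"
      using y zero by (simp add: scaleR_left_diff_distrib sum_subtractf)
    finally show ?thesis by simp
  qed
  have "polar_simplices S \<alpha> (\<lambda>x. x - z) p"
  proof
    show "x \<bullet> y = - (\<Sum>k\<in>S. \<alpha> k * (p k \<bullet> x) * ((k - z) \<bullet> y))" for x y
      by (subst expand[of x]) (simp add: inner_sum_left)
  qed (use fin pos sum1 pp in auto)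
  then show thesis ..
qed

text \<open>The foot of the perpendicular from \<open>z\<close> to the facet plane is
  \<open>z + q\<close>, with barycentric coordinates \<open>u\<close>. Here \<open>u s = 0\<close>,
  and \<open>u k > 0\<close> amounts to \<open>p s \<bullet> p k < p s \<bullet> p s\<close>, so the
  foot is in the relative interior of the facet.\<close>

lemma facet_equilibrium:
  fixes S :: "'a::euclidean_space set"
  assumes "polar_simplices S \<alpha> (\<lambda>x. x - z) p" and indep: "\<not> affine_dependent S"
    and s: "s \<in> S" and less: "\<forall>k\<in>S - {s}. p s \<bullet> p k < p s \<bullet> p s" and "p s \<noteq> 0"
  shows "equilibrium_on (convex hull S) z (convex hull (S - {s}))"
proof -
  interpret polar_simplices S \<alpha> "\<lambda>x. x - z" p by fact
  interpret dual: polar_simplices S \<alpha> p "\<lambda>x. x - z" by (rule polar_dual)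
  define q where "q = (1 / (p s \<bullet> p s)) *\<^sub>R p s"
  have ps: "p s \<bullet> p s > 0" using \<open>p s \<noteq> 0\<close> by simp
  have sq: "p s \<bullet> q = 1" using ps by (simp add: q_def)
  have qq: "q \<bullet> x = (p s \<bullet> x) / (p s \<bullet> p s)" for x by (simp add: q_def)
  define u where "u k = \<alpha> k * (1 - p k \<bullet> q)" for k
  have us: "u s = 0" by (simp add: u_def sq)
  have upos: "u k > 0" if "k \<in> S - {s}" for k
    using less that weight_pos[of k] ps by (simp add: u_def q_def inner_commute)
  have "sum u S = 1"
    by (simp add: u_def right_diff_distrib sum_subtractf weight_sum weighted_inner_sum)
  then have u1: "sum u (S - {s}) = 1" using us s finite_I by (simp add: sum_diff1)
  have z0: "(\<Sum>k\<in>S. \<alpha> k *\<^sub>R (k - z)) = 0" by (rule dual.weighted_polar_sum)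
  \<comment> \<open>This is \<open>inner_expand\<close> in vector form. Adding the vanishing
    weighted sum of the \<open>k - z\<close> turns its coefficients into \<open>u k\<close>.\<close>
  have "y \<bullet> (- (\<Sum>k\<in>S. (\<alpha> k * (p k \<bullet> q)) *\<^sub>R (k - z))) = y \<bullet> q" for y
    by (subst (2) inner_commute, subst (2) inner_expand) (simp add: inner_sum_right inner_commute)
  then have "- (\<Sum>k\<in>S. (\<alpha> k * (p k \<bullet> q)) *\<^sub>R (k - z)) = q"
    using vector_eq_ldot by blast
  then have "(\<Sum>k\<in>S. u k *\<^sub>R (k - z)) = q"
    using z0 by (simp add: u_def right_diff_distrib scaleR_left_diff_distrib sum_subtractf)
  then have "(\<Sum>k\<in>S - {s}. u k *\<^sub>R (k - z)) = q"
    using us s finite_I by (simp add: sum_diff1)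
  then have uq: "(\<Sum>k\<in>S - {s}. u k *\<^sub>R k) = z + q"
    using u1 by (simp add: scaleR_diff_right sum_subtractf algebra_simps flip: scaleR_left.sum)
  have "\<not> affine_dependent (S - {s})" using affine_independent_Diff[OF indep] .
  then have rel: "z + q \<in> rel_interior (convex hull (S - {s}))"
    using upos u1 uq by (subst rel_interior_convex_hull_explicit) auto
  moreover have "convex hull (S - {s}) \<subseteq> convex hull S" by (rule hull_mono) auto
  ultimately have "z + q \<in> convex hull S" using rel_interior_subset by blast
  moreover have "(x - (z + q)) \<bullet> q \<le> 0" if "x \<in> convex hull S" for x
  proof -
    have "S \<subseteq> {x. p s \<bullet> x \<le> 1 + p s \<bullet> z}"
    proof
      fix k assume k: "k \<in> S"
      then have "p s \<bullet> (k - z) \<le> 1" using inner_polar[OF s k] weight_pos[OF s] by auto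
      then show "k \<in> {x. p s \<bullet> x \<le> 1 + p s \<bullet> z}" by (simp add: inner_diff_right)
    qed
    then have "convex hull S \<subseteq> {x. p s \<bullet> x \<le> 1 + p s \<bullet> z}"
      by (intro hull_minimal convex_halfspace_le)
    then have "p s \<bullet> (x - (z + q)) \<le> 0"
      using that sq by (auto simp: inner_diff_right inner_add_right)
    then show ?thesis using ps by (simp add: inner_commute[of _ q] qq divide_nonpos_pos)
  qed
  ultimately show ?thesis
    using rel unfolding equilibrium_on_def supports_perp_plane_def by fastforce
qed

text \<open>A point is its own relative interior, and a closed half-space contains the hull iff it
  contains \<open>S\<close>.\<close>

lemma vertex_equilibrium_iff:
  fixes S :: "'a::euclidean_space set"
  assumes "s \<in> S"
  shows "equilibrium_on (convex hull S) z {s} \<longleftrightarrow> (\<forall>x\<in>S. (s - z) \<bullet> (x - z) \<le> (s - z) \<bullet> (s - z))"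
proof -
  have "equilibrium_on (convex hull S) z {s} \<longleftrightarrow> (\<forall>x\<in>convex hull S. (x - s) \<bullet> (s - z) \<le> 0)"
    using hull_inc[OF assms] by (simp add: equilibrium_on_def supports_perp_plane_def)
  also have "\<dots> \<longleftrightarrow> convex hull S \<subseteq> {x. (s - z) \<bullet> x \<le> (s - z) \<bullet> s}"
    by (auto simp: inner_diff_left inner_diff_right inner_commute algebra_simps)
  also have "\<dots> \<longleftrightarrow> S \<subseteq> {x. (s - z) \<bullet> x \<le> (s - z) \<bullet> s}"
    by (metis convex_halfspace_le hull_subset order_trans subset_hull)
  also have "\<dots> \<longleftrightarrow> (\<forall>x\<in>S. (s - z) \<bullet> (x - z) \<le> (s - z) \<bullet> (s - z))"
    by (auto simp: inner_diff_left inner_diff_right inner_commute algebra_simps)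
  finally show ?thesis .
qed

section \<open>Monostable weighted tetrahedra\<close>

theorem theorem1p8:
  fixes a b c d z :: "real^3"
  assumes "card {a, b, c, d} = 4"
    and "\<not> affine_dependent {a, b, c, d}"
    and "z \<in> interior (convex hull {a, b, c, d})"
    and "monostable (convex hull {a, b, c, d}) z"
  shows "card {v. v extreme_point_of (convex hull {a, b, c, d})
                  \<and> equilibrium_on (convex hull {a, b, c, d}) z {v}} = 2"
proof -
  define S where "S = {a, b, c, d}"
  have card: "card S = 4" and indep: "\<not> affine_dependent S" and z: "z \<in> interior (convex hull S)"
    and mono: "monostable (convex hull S) z"
    using assms by (simp_all add: S_def)
  have fin: "finite S" by (simp add: S_def)
  obtain \<alpha> p where "polar_simplices S \<alpha> (\<lambda>x. x - z) p"
    using polar_simplices_exist[OF indep _ z] card by auto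
  then interpret polar_simplices S \<alpha> "\<lambda>x. x - z" p .
  obtain F0 where F0: "{F \<in> faces2 (convex hull S). equilibrium_on (convex hull S) z F} = {F0}"
    using mono unfolding monostable_def by (auto simp: card_1_singleton_iff)
  \<comment> \<open>An index without polar escape yields an equilibrium on its opposite facet, which
    monostability identifies with \<open>F0\<close>. As opposite facets determine their vertices,
    there is at most one such index.\<close>
  have facet: "convex hull (S - {s}) = F0"
    if s: "s \<in> S" "\<forall>k\<in>S - {s}. p s \<bullet> p k < p s \<bullet> p s" for s
  proof -
    have "card (S - {s}) = 3" using card s(1) fin by simp
    then have "S - {s} \<noteq> {}" by (metis card.empty zero_neq_numeral)
    then have "p s \<noteq> 0" using s(2) by auto
    then have "equilibrium_on (convex hull S) z (convex hull (S - {s}))"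
      using facet_equilibrium[OF polar_simplices_axioms indep s] by simp
    moreover have "convex hull (S - {s}) face_of convex hull S"
      using face_of_convex_hull_affine_independent[OF indep] by blast
    moreover have "aff_dim (convex hull (S - {s})) = 2"
      using aff_dim_affine_independent[OF affine_independent_Diff[OF indep, of "{s}"]] card s(1) fin
      by (simp add: aff_dim_convex_hull)
    ultimately show ?thesis using F0 unfolding faces2_def by blast
  qed
  have inj: "s = t" if "s \<in> S" "t \<in> S" "convex hull (S - {s}) = convex hull (S - {t})" for s t
  proof (rule ccontr)
    assume "s \<noteq> t"
    then have "s \<in> convex hull (S - {s})" using that by (simp add: hull_inc)
    then have "s \<in> affine hull (S - {s})" using convex_hull_subset_affine_hull by blast
    then show False using indep that(1) unfolding affine_dependent_def by blast
  qed
  have "card {s \<in> S. \<forall>x\<in>S. (s - z) \<bullet> (x - z) \<le> (s - z) \<bullet> (s - z)} = 2"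
  proof (rule card_vertex_equilibria[OF card])
    fix i j
    assume "i \<in> S" "j \<in> S" "\<forall>k\<in>S - {i}. p i \<bullet> p k < p i \<bullet> p i" "\<forall>k\<in>S - {j}. p j \<bullet> p k < p j \<bullet> p j"
    then show "i = j" using facet inj by metis
  qed
  moreover have "{v. v extreme_point_of (convex hull S) \<and> equilibrium_on (convex hull S) z {v}}
      = {s \<in> S. \<forall>x\<in>S. (s - z) \<bullet> (x - z) \<le> (s - z) \<bullet> (s - z)}"
    using vertex_equilibrium_iff extreme_point_of_convex_hull_affine_independent[OF indep] by blast
  ultimately show ?thesis by (simp add: S_def)
qed

end
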